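(* Any radial eigencubic $f$ in $\mathbb{R}^n$ is a harmonic function, i.e. $\Delta f=0$.
   Context: For a polynomial $f\in\mathbb{R}[x_1,\dots,x_n]$ put $L(f)=|\nabla f|^2\Delta f-\sum_{i,j=1}^n f_{x_i}f_{x_j}f_{x_ix_j}$. A radial eigencubic in $\mathbb{R}^n$ is a homogeneous polynomial $f\not\equiv 0$ of degree 3 such that $L(f)=\lambda |x|^2 f$ for some constant $\lambda\in\mathbb{R}$.
   Formalization: The formal theorem additionally assumes that L(f) is not identically zero, i.e. λ ≠ 0; with λ = 0 the claim fails, since f = x_1^3 satisfies L(f) = 0 but Δf = 6x_1 ≠ 0. *)

theory Defs
  imports "HOL-Analysis.Analysis"
begin

(* Polynomials in R[x_1,...,x_n] are represented by the functions on R^n they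
   induce (a faithful identification, R being infinite).
   The set of exponents a below is finite, so the sum is a genuine one. *)
definition homogeneous_polynomial :: "nat \<Rightarrow> (real ^ 'n \<Rightarrow> real) \<Rightarrow> bool" where
  "homogeneous_polynomial d f \<longleftrightarrow>
     (\<exists>c :: ('n \<Rightarrow> nat) \<Rightarrow> real.
        \<forall>x. f x = (\<Sum>a | (\<Sum>i\<in>UNIV. a i) = d. c a * (\<Prod>i\<in>UNIV. (x $ i) ^ a i)))"

lemma finite_exponents: "finite {a :: 'n::finite \<Rightarrow> nat. (\<Sum>i\<in>UNIV. a i) = d}"
proof (rule finite_subset)
  show "{a :: 'n \<Rightarrow> nat. (\<Sum>i\<in>UNIV. a i) = d} \<subseteq> (\<Pi>\<^sub>E i\<in>UNIV. {..d})"
    by (auto simp: member_le_sum)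
  show "finite (\<Pi>\<^sub>E i\<in>(UNIV :: 'n set). {..d})"
    by (intro finite_PiE) auto
qed

definition partial :: "'n \<Rightarrow> (real ^ 'n \<Rightarrow> real) \<Rightarrow> real ^ 'n \<Rightarrow> real" where
  "partial i f x = deriv (\<lambda>t. f (x + t *\<^sub>R axis i 1)) 0"

definition gradient :: "(real ^ 'n \<Rightarrow> real) \<Rightarrow> real ^ 'n \<Rightarrow> real ^ 'n" where
  "gradient f x = (\<chi> i. partial i f x)"

definition laplacian :: "(real ^ 'n \<Rightarrow> real) \<Rightarrow> real ^ 'n \<Rightarrow> real" where
  "laplacian f x = (\<Sum>i\<in>UNIV. partial i (partial i f) x)"

definition L_op :: "(real ^ 'n \<Rightarrow> real) \<Rightarrow> real ^ 'n \<Rightarrow> real" where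
  "L_op f x = (norm (gradient f x))\<^sup>2 * laplacian f x
     - (\<Sum>i\<in>UNIV. \<Sum>j\<in>UNIV. partial i f x * partial j f x * partial j (partial i f) x)"

definition radial_eigencubic :: "(real ^ 'n \<Rightarrow> real) \<Rightarrow> bool" where
  "radial_eigencubic f \<longleftrightarrow>
     homogeneous_polynomial 3 f \<and> (\<exists>x. f x \<noteq> 0) \<and>
     (\<exists>c::real. \<forall>x. L_op f x = c * (norm x)\<^sup>2 * f x)"

definition harmonic :: "(real ^ 'n \<Rightarrow> real) \<Rightarrow> bool" where
  "harmonic f \<longleftrightarrow> (\<forall>x. laplacian f x = 0)"

end

theory Submission
  imports Defs
begin

text \<open>Polarising the cubic gives a commutative product with
  \<open>f x = \<langle>x \<odot> x, x\<rangle> / 6\<close> and \<open>\<langle>x \<odot> y, z\<rangle> = \<langle>x, y \<odot> z\<rangle>\<close>; the Hessian of \<open>f\<close> at \<open>x\<close> is the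
  multiplication \<open>L\<^sub>x\<close>, so \<open>\<Delta>f(x) = tr L\<^sub>x\<close>. The equation becomes
  \<open>|x \<odot> x|\<^sup>2 tr L\<^sub>x - \<langle>x \<odot> x, x \<odot> (x \<odot> x)\<rangle> = \<kappa> |x|\<^sup>2 \<langle>x \<odot> x, x\<rangle>\<close> with \<open>\<kappa> \<noteq> 0\<close>.
  A maximum point of \<open>f\<close> on the sphere yields an idempotent \<open>c\<close> whose multiplication has
  eigenvalues at most 1/2 on the orthogonal complement of \<open>c\<close>. With \<open>k = \<kappa> |c|\<^sup>2\<close>, expanding the
  equation at \<open>c + s y\<close> for \<open>y\<close> orthogonal to \<open>c\<close> gives \<open>tr L\<^sub>c = 1 + k\<close> and \<open>tr L\<^sub>y = 0\<close>, so it
  remains to see that \<open>k = -1\<close>. By the second order, the eigenvalues of \<open>L\<^sub>c\<close> on the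
  complement are roots of \<open>4\<mu>\<^sup>3 - 4k\<mu>\<^sup>2 + k\<mu> + k\<close>, and they sum to \<open>k\<close>. If \<open>k > 0\<close>, some
  eigenvalue lies in \<open>(0, 1/2]\<close>, where the cubic is positive. If \<open>k < 0\<close>, some eigenvalue is
  negative, and the third and fourth orders, applied to its eigenvector \<open>y\<close> and to the component
  of \<open>y \<odot> y\<close> orthogonal to \<open>c\<close>, leave only \<open>k = -1\<close>.\<close>

section \<open>Real polynomials in one variable and self-adjoint maps\<close>

text \<open>First and second order conditions for a maximum at s = 0: divide by s, respectively s^2,
  and let s tend to 0.\<close>

lemma poly4_nonpos:
  fixes a b c d :: real
  assumes le: "\<And>s. a * s + b * s\<^sup>2 + c * s ^ 3 + d * s ^ 4 \<le> 0"
  shows "a = 0" "b \<le> 0"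
proof -
  have lim: "((\<lambda>s. a + b * s + c * s\<^sup>2 + d * s ^ 3) \<longlongrightarrow> a + b * 0 + c * 0\<^sup>2 + d * 0 ^ 3) (at 0 within S)" for S
    by (intro tendsto_intros)
  have "a \<le> 0"
  proof -
    have "eventually (\<lambda>s. a + b * s + c * s\<^sup>2 + d * s ^ 3 \<le> 0) (at_right 0)"
      using eventually_at_right_less
    proof eventually_elim
      case (elim s)
      have "s * (a + b * s + c * s\<^sup>2 + d * s ^ 3) \<le> 0"
        using le[of s] by (simp add: algebra_simps power2_eq_square power3_eq_cube power4_eq_xxxx)
      with elim show ?case by (simp add: mult_le_0_iff)
    qed
    from tendsto_upperbound[OF lim this] show ?thesis by simp
  qed
  moreover have "a \<ge> 0"
  proof -
    have "eventually (\<lambda>s. a + b * s + c * s\<^sup>2 + d * s ^ 3 \<ge> 0) (at_left 0)"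
      unfolding eventually_at_left_field
    proof (intro exI[of _ "-1"] conjI allI impI)
      fix s :: real assume "-1 < s" "s < 0"
      have "s * (a + b * s + c * s\<^sup>2 + d * s ^ 3) \<le> 0"
        using le[of s] by (simp add: algebra_simps power2_eq_square power3_eq_cube power4_eq_xxxx)
      with \<open>s < 0\<close> show "a + b * s + c * s\<^sup>2 + d * s ^ 3 \<ge> 0" by (simp add: mult_le_0_iff)
    qed simp
    from tendsto_lowerbound[OF lim this] show ?thesis by simp
  qed
  ultimately show "a = 0" by simp
  have lim: "((\<lambda>s. b + c * s + d * s\<^sup>2) \<longlongrightarrow> b + c * 0 + d * 0\<^sup>2) (at_right 0)"
    by (intro tendsto_intros)
  have "eventually (\<lambda>s. b + c * s + d * s\<^sup>2 \<le> 0) (at_right 0)"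
    using eventually_at_right_less
  proof eventually_elim
    case (elim s)
    have "s\<^sup>2 * (b + c * s + d * s\<^sup>2) \<le> 0"
      using le[of s] \<open>a = 0\<close> by (simp add: algebra_simps power2_eq_square power3_eq_cube power4_eq_xxxx)
    with elim show ?case by (simp add: mult_le_0_iff)
  qed
  from tendsto_upperbound[OF lim this] show "b \<le> 0" by simp
qed

text \<open>Vanishing at six distinct nodes forces a quintic to be zero; this lets coefficients in s
  be compared.\<close>

lemma poly5_eq_0:
  fixes a b c d e g :: real
  assumes "\<And>s. a + b * s + c * s\<^sup>2 + d * s ^ 3 + e * s ^ 4 + g * s ^ 5 = 0"
  shows "a = 0" "b = 0" "c = 0" "d = 0" "e = 0" "g = 0"
  using assms[of 0] assms[of 1] assms[of "-1"] assms[of 2] assms[of "-2"] assms[of 3] by simp_all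

text \<open>The maximum of the Rayleigh quotient on the unit sphere of \<open>W\<close> is attained
  at an eigenvector, and \<open>y0\<close> makes that maximum positive.\<close>

lemma self_adjoint_positive_eigenvector:
  fixes A :: "'a::euclidean_space \<Rightarrow> 'a"
  assumes lin: "linear A" and sym: "\<And>x y. A x \<bullet> y = x \<bullet> A y"
    and W: "subspace W" "\<And>x. x \<in> W \<Longrightarrow> A x \<in> W"
    and y0: "y0 \<in> W" "A y0 \<bullet> y0 > 0"
  obtains y \<mu> where "y \<in> W" "y \<noteq> 0" "A y = \<mu> *\<^sub>R y" "\<mu> > 0"
proof -
  define S where "S = W \<inter> sphere 0 1"
  have "y0 \<noteq> 0" using y0 by auto
  define e where "e = (1 / norm y0) *\<^sub>R y0"
  have "e \<in> S" using \<open>y0 \<noteq> 0\<close> y0 W(1) by (auto simp: S_def e_def subspace_scale)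
  have "compact S" unfolding S_def
    by (intro closed_Int_compact closed_subspace W(1) compact_sphere)
  moreover have "continuous_on S (\<lambda>x. A x \<bullet> x)"
    by (intro continuous_on_inner linear_continuous_on continuous_on_id)
      (use lin linear_conv_bounded_linear in blast)
  ultimately obtain y where y: "y \<in> S" and ymax: "\<And>x. x \<in> S \<Longrightarrow> A x \<bullet> x \<le> A y \<bullet> y"
    using continuous_attains_sup[of S "\<lambda>x. A x \<bullet> x"] \<open>e \<in> S\<close> by blast
  define \<mu> where "\<mu> = A y \<bullet> y"
  have yW: "y \<in> W" and [simp]: "y \<bullet> y = 1" and "y \<noteq> 0"
    using y by (auto simp: S_def dot_square_norm)
  note [simp] = linear_add[OF lin] linear_scale[OF lin]
  have "A e \<bullet> e > 0" using y0 \<open>y0 \<noteq> 0\<close> by (simp add: e_def)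
  hence "\<mu> > 0" using ymax[OF \<open>e \<in> S\<close>] by (simp add: \<mu>_def)
  have rayleigh: "A x \<bullet> x \<le> \<mu> * (x \<bullet> x)" if "x \<in> W" for x
  proof (cases "x = 0")
    case False
    have "(1 / norm x) *\<^sub>R x \<in> S" using False that W(1) by (auto simp: S_def subspace_scale)
    from ymax[OF this] False show ?thesis
      by (simp add: \<mu>_def[symmetric] dot_square_norm field_simps power2_eq_square)
  qed (simp add: linear_0[OF lin])
  define z where "z = A y - \<mu> *\<^sub>R y"
  have zW: "z \<in> W" unfolding z_def using yW W by (intro subspace_diff subspace_scale) auto
  \<comment> \<open>The Rayleigh bound at y + s z, padded to a quartic for
    \<open>poly4_nonpos\<close>; its first-order coefficient is 2 |z|^2, so the residual z
    vanishes.\<close>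
  have "2 * (z \<bullet> z) * s + (A z \<bullet> z - \<mu> * (z \<bullet> z)) * s\<^sup>2 + 0 * s ^ 3 + 0 * s ^ 4 \<le> 0" for s
  proof -
    have "y + s *\<^sub>R z \<in> W" using yW zW W(1) by (intro subspace_add subspace_scale)
    from rayleigh[OF this]
    have "\<mu> + 2 * s * (A y \<bullet> z) + s\<^sup>2 * (A z \<bullet> z) \<le> \<mu> * (1 + 2 * s * (y \<bullet> z) + s\<^sup>2 * (z \<bullet> z))"
      using sym[of z y] \<mu>_def
      by (simp add: inner_simps inner_commute algebra_simps power2_eq_square)
    moreover have "A y \<bullet> z = z \<bullet> z + \<mu> * (y \<bullet> z)"
      by (subst (2) z_def) (simp add: inner_simps)
    ultimately show ?thesis by (simp add: algebra_simps)
  qed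
  from poly4_nonpos(1)[OF this] have "z = 0" by simp
  hence "A y = \<mu> *\<^sub>R y" by (simp add: z_def)
  with yW \<open>y \<noteq> 0\<close> \<open>\<mu> > 0\<close> show ?thesis using that by blast
qed

section \<open>Metrized algebras and their maximal idempotents\<close>

locale metrized_algebra =
  fixes mul :: "'a::euclidean_space \<Rightarrow> 'a \<Rightarrow> 'a"  (infixl "\<odot>" 70)
  assumes bilin: "bilinear mul"
    and commute: "x \<odot> y = y \<odot> x"
    and assoc_form: "(x \<odot> y) \<bullet> z = x \<bullet> (y \<odot> z)"
begin

lemmas distrib = bilinear_ladd[OF bilin] bilinear_radd[OF bilin] bilinear_lsub[OF bilin]
  bilinear_rsub[OF bilin] bilinear_lmul[OF bilin] bilinear_rmul[OF bilin]
  bilinear_lneg[OF bilin] bilinear_rneg[OF bilin]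

lemma self_adjoint: "(x \<odot> y) \<bullet> z = y \<bullet> (x \<odot> z)"
  by (metis assoc_form commute)

definition tr :: "'a \<Rightarrow> real" where
  "tr x = (\<Sum>b\<in>Basis. (x \<odot> b) \<bullet> b)"

lemma tr_linear: "tr (x + y) = tr x + tr y" "tr (s *\<^sub>R x) = s * tr x"
  by (simp_all add: tr_def distrib inner_simps sum.distrib sum_distrib_left)

lemma cube_expand:
  "((x + s *\<^sub>R y) \<odot> (x + s *\<^sub>R y)) \<bullet> (x + s *\<^sub>R y) =
    (x \<odot> x) \<bullet> x + 3 * s * ((x \<odot> x) \<bullet> y) + 3 * s\<^sup>2 * ((x \<odot> y) \<bullet> y) + s ^ 3 * ((y \<odot> y) \<bullet> y)"
proof -
  have "(x \<odot> y) \<bullet> x = (x \<odot> x) \<bullet> y" "(y \<odot> x) \<bullet> x = (x \<odot> x) \<bullet> y"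
    "(y \<odot> x) \<bullet> y = (x \<odot> y) \<bullet> y" "(y \<odot> y) \<bullet> x = (x \<odot> y) \<bullet> y"
    using assoc_form[of x y x] assoc_form[of x x y] assoc_form[of y x y]
      assoc_form[of x y y] assoc_form[of y y x] commute[of x y] by (auto simp: inner_commute)
  then show ?thesis
    by (simp add: distrib inner_simps algebra_simps power2_eq_square power3_eq_cube)
qed

text \<open>At a maximum point e of the cubic on the sphere, with value M, the first order gives e
  \<odot> e = M e and the second bounds the quadratic form of e by M/2 on its complement. Rescaling
  to c = e/M normalises both.\<close>

lemma exists_maximal_idempotent:
  assumes "(x0 \<odot> x0) \<bullet> x0 \<noteq> 0"
  obtains c where "c \<noteq> 0" "c \<odot> c = c" "\<And>y. y \<bullet> c = 0 \<Longrightarrow> (c \<odot> y) \<bullet> y \<le> (y \<bullet> y) / 2"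
proof -
  define q where "q = (\<lambda>x. (x \<odot> x) \<bullet> x)"
  interpret bb: bounded_bilinear mul
    using bilin by (simp add: bilinear_conv_bounded_bilinear)
  have qscale: "q (s *\<^sub>R x) = s ^ 3 * q x" for s x
    by (simp add: q_def distrib power3_eq_cube algebra_simps)
  have "continuous_on (sphere 0 1) q" unfolding q_def
    by (intro continuous_on_inner bb.continuous_on continuous_on_id)
  moreover have "x0 \<noteq> 0" using assms by auto
  then have "(1 / norm x0) *\<^sub>R x0 \<in> sphere 0 1" by simp
  hence "sphere (0 :: 'a) 1 \<noteq> {}" by blast
  ultimately obtain e where e: "e \<in> sphere 0 1" and emax: "\<And>x. x \<in> sphere 0 1 \<Longrightarrow> q x \<le> q e"
    using continuous_attains_sup[of "sphere 0 1" q] compact_sphere by blast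
  define M where "M = q e"
  have [simp]: "e \<bullet> e = 1" "e \<noteq> 0" using e by (auto simp: dot_square_norm)
  have qle: "q x \<le> M * norm x ^ 3" for x
  proof (cases "x = 0")
    case False
    have "q ((1 / norm x) *\<^sub>R x) \<le> M" unfolding M_def using False by (intro emax) simp
    then show ?thesis using False unfolding qscale by (simp add: field_simps)
  qed (simp add: q_def)
  have "M > 0"
  proof -
    \<comment> \<open>The cubic is odd, so it is positive at one of x0 and -x0.\<close>
    have "q x0 \<le> M * norm x0 ^ 3" "- q x0 \<le> M * norm x0 ^ 3"
      using qle[of x0] qle[of "-x0"] qscale[of "-1" x0] by auto
    moreover have "q x0 \<noteq> 0" using assms by (simp add: q_def)
    ultimately have "0 < M * norm x0 ^ 3" by linarith
    then show ?thesis by (simp add: zero_less_mult_iff)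
  qed
  \<comment> \<open>The norm contributes (1 + a)^(3/2) with a = s^2 |y|^2. Bounding it by 1 + 3a/2 +
    a^2, which agrees to first order in a, keeps the inequality polynomial in s without weakening
    its second order.\<close>
  have main: "3 * ((e \<odot> e) \<bullet> y) * s + (3 * ((e \<odot> y) \<bullet> y) - 3 / 2 * M * (y \<bullet> y)) * s\<^sup>2
      + q y * s ^ 3 + (- M * (y \<bullet> y)\<^sup>2) * s ^ 4 \<le> 0" if "y \<bullet> e = 0" for y s
  proof -
    define a where "a = s\<^sup>2 * (y \<bullet> y)"
    have "a \<ge> 0" by (simp add: a_def)
    have "(norm (e + s *\<^sub>R y))\<^sup>2 = 1 + a"
      unfolding power2_norm_eq_inner a_def using that
      by (simp add: inner_simps inner_commute power2_eq_square)
    hence "(norm (e + s *\<^sub>R y) ^ 3)\<^sup>2 = (1 + a) ^ 3"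
      by (metis power_mult mult.commute)
    also have "\<dots> \<le> (1 + 3 / 2 * a + a\<^sup>2)\<^sup>2"
    proof -
      have "(1 + 3 / 2 * a + a\<^sup>2)\<^sup>2 - (1 + a) ^ 3 = 5 / 4 * a\<^sup>2 + 2 * a ^ 3 + a ^ 4"
        by (simp add: power2_eq_square power3_eq_cube power4_eq_xxxx field_simps)
      also have "\<dots> \<ge> 0" using \<open>a \<ge> 0\<close> by simp
      finally show ?thesis by simp
    qed
    finally have "norm (e + s *\<^sub>R y) ^ 3 \<le> 1 + 3 / 2 * a + a\<^sup>2"
      using \<open>a \<ge> 0\<close> by - (rule power2_le_imp_le, simp_all)
    hence "q (e + s *\<^sub>R y) \<le> M * (1 + 3 / 2 * a + a\<^sup>2)"
      using qle[of "e + s *\<^sub>R y"] \<open>M > 0\<close> by (smt (verit) mult_left_mono)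
    moreover have "q (e + s *\<^sub>R y) = M + 3 * s * ((e \<odot> e) \<bullet> y) + 3 * s\<^sup>2 * ((e \<odot> y) \<bullet> y) + s ^ 3 * q y"
      unfolding q_def M_def by (rule cube_expand)
    ultimately show ?thesis
      by (simp add: a_def algebra_simps power_mult_distrib flip: power_mult)
  qed
  note first = poly4_nonpos(1)[OF main] and second = poly4_nonpos(2)[OF main]
  define w where "w = e \<odot> e - M *\<^sub>R e"
  have we: "w \<bullet> e = 0" by (simp add: w_def inner_simps M_def q_def)
  have "w \<bullet> w = (e \<odot> e) \<bullet> w - M * (e \<bullet> w)" by (subst w_def) (simp add: inner_simps)
  also have "\<dots> = 0" using first[OF we] we by (simp add: inner_commute)
  finally have ee: "e \<odot> e = M *\<^sub>R e" by (simp add: w_def)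
  define c where "c = (1 / M) *\<^sub>R e"
  show ?thesis
  proof (rule that[of c])
    show "c \<noteq> 0" "c \<odot> c = c" using \<open>M > 0\<close> by (simp_all add: c_def distrib ee)
    fix y assume "y \<bullet> c = 0"
    hence "y \<bullet> e = 0" using \<open>M > 0\<close> by (simp add: c_def)
    from second[OF this] \<open>M > 0\<close> show "(c \<odot> y) \<bullet> y \<le> (y \<bullet> y) / 2"
      by (simp add: c_def distrib field_simps)
  qed
qed

end

section \<open>The eigencubic identity expanded at an idempotent\<close>

locale hsiang_algebra = metrized_algebra +
  fixes \<kappa> :: real
  assumes hsiang: "((x \<odot> x) \<bullet> (x \<odot> x)) * tr x - (x \<odot> x) \<bullet> (x \<odot> (x \<odot> x)) = \<kappa> * (x \<bullet> x) * ((x \<odot> x) \<bullet> x)"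
begin

context
  fixes c :: 'a and k :: real
  assumes c: "c \<noteq> 0" "c \<odot> c = c" and k: "k = \<kappa> * (c \<bullet> c)"
begin

text \<open>These are the coefficients of s^0 to s^4 in \<open>hsiang\<close> at c + s y. The first
  two determine the traces of c and y, which are then substituted into the others.\<close>

lemma idempotent_expansion:
  assumes y: "y \<bullet> c = 0"
  shows "tr c = 1 + k" (is ?trc) "tr y = 0" (is ?try)
    "4 * ((c \<odot> (c \<odot> y)) \<bullet> (c \<odot> y)) - 4 * k * ((c \<odot> y) \<bullet> (c \<odot> y)) + k * ((c \<odot> y) \<bullet> y) + k * (y \<bullet> y) = 0" (is ?order2)
    "(4 * k + 2) * ((y \<odot> y) \<bullet> (c \<odot> y)) - 4 * ((y \<odot> (c \<odot> y)) \<bullet> (c \<odot> y))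
      - 4 * ((c \<odot> (c \<odot> y)) \<bullet> (y \<odot> y)) - k * ((y \<odot> y) \<bullet> y) = 0" (is ?order3)
    "(1 + k) * ((y \<odot> y) \<bullet> (y \<odot> y)) - 4 * ((y \<odot> y) \<bullet> (y \<odot> (c \<odot> y))) - (y \<odot> y) \<bullet> (c \<odot> (y \<odot> y))
      = 3 * \<kappa> * (y \<bullet> y) * ((c \<odot> y) \<bullet> y)" (is ?order4)
proof -
  define a w where "a = c \<odot> y" and "w = y \<odot> y"
  \<comment> \<open>Invariance of the form and y orthogonal to c reduce each scalar of the expansion
    to one chosen representative.\<close>
  have ip: "c \<bullet> y = 0" "c \<bullet> a = 0" "a \<bullet> c = 0" "c \<bullet> w = a \<bullet> y" "w \<bullet> c = a \<bullet> y"
    "c \<bullet> (c \<odot> a) = 0" "c \<bullet> (y \<odot> a) = a \<bullet> a" "c \<bullet> (c \<odot> w) = a \<bullet> y" "c \<bullet> (y \<odot> w) = a \<bullet> w"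
    "a \<bullet> (c \<odot> w) = (c \<odot> a) \<bullet> w" "a \<bullet> (y \<odot> w) = w \<bullet> (y \<odot> a)"
    "a \<bullet> (c \<odot> a) = (c \<odot> a) \<bullet> a" "a \<bullet> (y \<odot> a) = (y \<odot> a) \<bullet> a"  "w \<bullet> (c \<odot> a) = (c \<odot> a) \<bullet> w"
    "w \<bullet> a = a \<bullet> w"
    unfolding a_def w_def using y c(2)
    by (metis assoc_form commute inner_commute)+
  have cy: "y \<odot> c = a" "a \<odot> c = c \<odot> a" "w \<odot> c = c \<odot> w" "c \<odot> y = a" "y \<odot> y = w"
    by (simp_all add: a_def w_def commute)
  have "(N * tr c - N - \<kappa> * N * N) + N * tr y * s
      + ((4 * (a \<bullet> a) + 2 * (a \<bullet> y)) * tr c - (4 * ((c \<odot> a) \<bullet> a) + 4 * (a \<bullet> a) + 2 * (a \<bullet> y))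
          - \<kappa> * N * (3 * (a \<bullet> y) + y \<bullet> y)) * s\<^sup>2
      + (4 * (a \<bullet> w) * tr c + (4 * (a \<bullet> a) + 2 * (a \<bullet> y)) * tr y
          - (2 * (a \<bullet> w) + 4 * ((y \<odot> a) \<bullet> a) + 4 * ((c \<odot> a) \<bullet> w)) - \<kappa> * N * (w \<bullet> y)) * s ^ 3
      + ((w \<bullet> w) * tr c + 4 * (a \<bullet> w) * tr y - (4 * (w \<bullet> (y \<odot> a)) + w \<bullet> (c \<odot> w))
          - 3 * \<kappa> * (y \<bullet> y) * (a \<bullet> y)) * s ^ 4
      + ((w \<bullet> w) * tr y - w \<bullet> (y \<odot> w) - \<kappa> * (y \<bullet> y) * (w \<bullet> y)) * s ^ 5 = 0"
    if N: "N = c \<bullet> c" for s N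
  proof -
    define x where "x = c + s *\<^sub>R y"
    have x2: "x \<odot> x = c + (2 * s) *\<^sub>R a + s\<^sup>2 *\<^sub>R w"
      by (simp add: x_def distrib cy c(2) algebra_simps power2_eq_square flip: scaleR_add_left)
    have x3: "x \<odot> (x \<odot> x) = c + s *\<^sub>R (a + 2 *\<^sub>R (c \<odot> a)) + s\<^sup>2 *\<^sub>R (2 *\<^sub>R (y \<odot> a) + c \<odot> w) + s ^ 3 *\<^sub>R (y \<odot> w)"
      unfolding x2 by (simp add: x_def distrib cy c(2) algebra_simps power2_eq_square power3_eq_cube)
    have "(x \<odot> x) \<bullet> (x \<odot> x) = N + (4 * (a \<bullet> a) + 2 * (a \<bullet> y)) * s\<^sup>2 + 4 * (a \<bullet> w) * s ^ 3 + (w \<bullet> w) * s ^ 4"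
      unfolding x2 N by (simp add: inner_simps ip algebra_simps power2_eq_square power3_eq_cube power4_eq_xxxx)
    moreover have "(x \<odot> x) \<bullet> (x \<odot> (x \<odot> x)) = N + (4 * ((c \<odot> a) \<bullet> a) + 4 * (a \<bullet> a) + 2 * (a \<bullet> y)) * s\<^sup>2
        + (2 * (a \<bullet> w) + 4 * ((y \<odot> a) \<bullet> a) + 4 * ((c \<odot> a) \<bullet> w)) * s ^ 3
        + (4 * (w \<bullet> (y \<odot> a)) + w \<bullet> (c \<odot> w)) * s ^ 4 + (w \<bullet> (y \<odot> w)) * s ^ 5"
      unfolding x3 unfolding x2 N
      by (simp add: inner_simps ip algebra_simps power2_eq_square power3_eq_cube power4_eq_xxxx eval_nat_numeral)
    moreover have "(x \<odot> x) \<bullet> x = N + 3 * (a \<bullet> y) * s\<^sup>2 + (w \<bullet> y) * s ^ 3"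
      unfolding x_def cube_expand N by (simp add: cy c(2) ip)
    moreover have "x \<bullet> x = N + (y \<bullet> y) * s\<^sup>2"
      unfolding x_def N by (simp add: inner_simps ip y power2_eq_square)
    moreover have "tr x = tr c + s * tr y" by (simp add: x_def tr_linear)
    ultimately show ?thesis using hsiang[of x] by simp algebra
  qed
  note coeffs = poly5_eq_0[OF this, OF refl]
  have N: "c \<bullet> c \<noteq> 0" using c by simp
  have "(c \<bullet> c) * (tr c - 1 - k) = 0" using coeffs(1) by (simp add: k algebra_simps)
  with N show trc: ?trc by simp
  show tr0: ?try using coeffs(2) N by simp
  show ?order2 ?order3 ?order4
    using coeffs(3-5) unfolding trc tr0 cy k[symmetric]
    by (simp_all add: algebra_simps inner_commute)
qed

section \<open>The spectrum of the idempotent on its orthogonal complement\<close>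

lemma orthogonal_mult: "y \<bullet> c = 0 \<Longrightarrow> (c \<odot> y) \<bullet> c = 0"
  by (metis self_adjoint c(2))

text \<open>The second-order identity says that the quadratic form of the self-adjoint operator P
  vanishes on the complement of c, which P preserves. Evaluating it at y + P y leaves 2 |P y|^2 =
  0.\<close>

lemma minimal_polynomial:
  assumes y: "y \<bullet> c = 0"
  shows "4 *\<^sub>R (c \<odot> (c \<odot> (c \<odot> y))) - (4 * k) *\<^sub>R (c \<odot> (c \<odot> y)) + k *\<^sub>R (c \<odot> y) + k *\<^sub>R y = 0"
proof -
  define P where "P x = 4 *\<^sub>R (c \<odot> (c \<odot> (c \<odot> x))) - (4 * k) *\<^sub>R (c \<odot> (c \<odot> x)) + k *\<^sub>R (c \<odot> x) + k *\<^sub>R x" for x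
  have P0: "P x \<bullet> x = 0" if "x \<bullet> c = 0" for x
    using idempotent_expansion(3)[OF that] self_adjoint[of c "c \<odot> (c \<odot> x)" x] self_adjoint[of c "c \<odot> x" x]
    by (simp add: P_def inner_simps)
  have "P y \<bullet> c = 0" using y by (simp add: P_def inner_simps orthogonal_mult)
  have P_add: "P (x + z) = P x + P z" for x z
    by (simp add: P_def distrib algebra_simps)
  have P_adj: "P x \<bullet> z = x \<bullet> P z" for x z
    by (simp add: P_def inner_simps self_adjoint)
  have "P (y + P y) \<bullet> (y + P y) = P y \<bullet> y + P (P y) \<bullet> P y + 2 * (P y \<bullet> P y)"
    by (simp add: P_add inner_simps P_adj[of "P y" y])
  then have "P y \<bullet> P y = 0"
    using P0[of y] P0[of "P y"] P0[of "y + P y"] y \<open>P y \<bullet> c = 0\<close> by (simp add: inner_simps)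
  then show ?thesis by (simp add: P_def)
qed

lemma eigenvalue_root:
  assumes "y \<bullet> c = 0" "y \<noteq> 0" "c \<odot> y = \<mu> *\<^sub>R y"
  shows "4 * \<mu> ^ 3 - 4 * k * \<mu>\<^sup>2 + k * \<mu> + k = 0"
proof -
  have "(4 * \<mu> ^ 3 - 4 * k * \<mu>\<^sup>2 + k * \<mu> + k) *\<^sub>R y = 0"
    using minimal_polynomial[OF assms(1)]
    by (simp add: assms(3) distrib algebra_simps power2_eq_square power3_eq_cube)
  with assms(2) show ?thesis by simp
qed

text \<open>The part of the third-order identity at \<open>y + z\<close> that is linear in \<open>z\<close>.\<close>

lemma eigenvector_square_relation:
  assumes y: "y \<bullet> c = 0" "c \<odot> y = \<mu> *\<^sub>R y" and z: "z \<bullet> c = 0"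
  shows "(y \<odot> y) \<bullet> ((8 * k * \<mu> + 4 * \<mu> - 12 * \<mu>\<^sup>2 - 3 * k) *\<^sub>R z
           + (4 * k + 2 - 8 * \<mu>) *\<^sub>R (c \<odot> z) - 4 *\<^sub>R (c \<odot> (c \<odot> z))) = 0"
proof -
  define a b w where "a = c \<odot> z" and "b = c \<odot> a" and "w = y \<odot> y"
  have eqs: "c \<odot> z = a" "c \<odot> a = b" "y \<odot> y = w" "z \<odot> y = y \<odot> z" "a \<odot> y = y \<odot> a" "a \<odot> z = z \<odot> a"
    by (simp_all add: a_def b_def w_def commute)
  have ip: "y \<bullet> (y \<odot> z) = w \<bullet> z" "y \<bullet> (y \<odot> a) = w \<bullet> a"
    "y \<bullet> (z \<odot> a) = a \<bullet> (y \<odot> z)" "z \<bullet> (y \<odot> a) = a \<bullet> (y \<odot> z)" "z \<bullet> (y \<odot> z) = y \<bullet> (z \<odot> z)"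
    unfolding w_def by (metis assoc_form commute inner_commute)+
  note ip = ip ip[unfolded inner_commute[of y] inner_commute[of z]]
  \<comment> \<open>For a cubic form F, F(y + z) - F(y - z) - 2 F(z) is twice the part linear in
    z.\<close>
  have "(y + z) \<bullet> c = 0" "(y - z) \<bullet> c = 0" using y z by (simp_all add: inner_simps)
  then show ?thesis
    using idempotent_expansion(4)[of "y + z"] idempotent_expansion(4)[of "y - z"] idempotent_expansion(4)[OF z]
    by (simp add: distrib y(2) eqs inner_simps ip inner_commute algebra_simps power2_eq_square)
qed

text \<open>Split y \<odot> y into r c and a part u orthogonal to c. If u = 0, the fourth order
  gives \<open>parallel\<close>; otherwise u is an eigenvector with eigenvalue \<mu> or k - 2\<mu>.
  In \<open>double_root\<close> the last equation is the derivative of the cubic at \<mu>; the roots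
  sum to k, so k - 2\<mu> is the third root.\<close>

lemma eigenvector_square_cases:
  assumes y: "y \<bullet> c = 0" "y \<noteq> 0" "c \<odot> y = \<mu> *\<^sub>R y" and "\<mu> \<noteq> 1 / 2" and "k \<noteq> 0"
  obtains (parallel) "k * (\<mu> - 3) = 4 * \<mu>\<^sup>2"
    | (degenerate) "(4 * \<mu> - 1) * (k - 2 * \<mu>) = 0"
    | (double_root) u where "u \<bullet> c = 0" "u \<noteq> 0" "c \<odot> u = (k - 2 * \<mu>) *\<^sub>R u" "12 * \<mu>\<^sup>2 - 8 * k * \<mu> + k = 0"
proof -
  define N where "N = c \<bullet> c"
  have "N > 0" using c by (simp add: N_def)
  define r where "r = \<mu> * (y \<bullet> y) / N"
  define u where "u = y \<odot> y - r *\<^sub>R c"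
  have root: "4 * \<mu> ^ 3 - 4 * k * \<mu>\<^sup>2 + k * \<mu> + k = 0" by (rule eigenvalue_root[OF y])
  hence "\<mu> \<noteq> 0" using \<open>k \<noteq> 0\<close> by auto
  have yyc: "(y \<odot> y) \<bullet> c = \<mu> * (y \<bullet> y)"
    using y(3) by (metis assoc_form commute inner_scaleR_right)
  have uc: "u \<bullet> c = 0" using \<open>N > 0\<close> by (simp add: u_def inner_simps yyc r_def N_def)
  define C D where "C = 8 * k * \<mu> + 4 * \<mu> - 12 * \<mu>\<^sup>2 - 3 * k" and "D = 4 * k + 2 - 8 * \<mu>"
  define G where "G x = C *\<^sub>R x + D *\<^sub>R (c \<odot> x) - 4 *\<^sub>R (c \<odot> (c \<odot> x))" for x
  have Gc: "G x \<bullet> c = 0" if "x \<bullet> c = 0" for x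
    using that by (simp add: G_def inner_simps orthogonal_mult)
  \<comment> \<open>G is self-adjoint and preserves the complement of c, so
    \<open>eigenvector_square_relation\<close> makes G u orthogonal to the complement in which it
    lies.\<close>
  have "G u \<bullet> z = 0" if "z \<bullet> c = 0" for z
  proof -
    have "G u \<bullet> z = u \<bullet> G z" by (simp add: G_def inner_simps self_adjoint)
    also have "\<dots> = (y \<odot> y) \<bullet> G z"
      using Gc[OF that] by (simp add: u_def inner_simps inner_commute[of c])
    also have "\<dots> = 0"
      using eigenvector_square_relation[OF y(1,3) that] by (simp add: G_def C_def D_def)
    finally show ?thesis .
  qed
  from this[OF Gc[OF uc]] have Gu: "C *\<^sub>R u + D *\<^sub>R (c \<odot> u) - 4 *\<^sub>R (c \<odot> (c \<odot> u)) = 0"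
    by (simp add: G_def)
  have cGu: "C *\<^sub>R (c \<odot> u) + D *\<^sub>R (c \<odot> (c \<odot> u)) - 4 *\<^sub>R (c \<odot> (c \<odot> (c \<odot> u))) = 0"
    using arg_cong[OF Gu, of "\<lambda>x. c \<odot> x"] bilinear_rzero[OF bilin] by (simp add: distrib)
  (* Eliminating between the quadratic relation Gu and the cubic minimal polynomial leaves a relation
     of degree one, so u is itself an eigenvector. *)
  have "(2 - 4 * \<mu>) * ((2 - 4 * \<mu>) * ((c \<odot> u) \<bullet> z) - (20 * \<mu>\<^sup>2 - 4 * \<mu> - 12 * k * \<mu> + 3 * k) * (u \<bullet> z)) = 0" for z
  proof -
    \<comment> \<open>Pairing with an arbitrary z turns the vector relations into scalar ones fit
      for algebraic elimination.\<close>
    define p0 p1 p2 p3 where "p0 = u \<bullet> z" and "p1 = (c \<odot> u) \<bullet> z"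
      and "p2 = (c \<odot> (c \<odot> u)) \<bullet> z" and "p3 = (c \<odot> (c \<odot> (c \<odot> u))) \<bullet> z"
    have "4 * p3 - 4 * k * p2 + k * p1 + k * p0 = 0"
      using arg_cong[OF minimal_polynomial[OF uc], of "\<lambda>x. x \<bullet> z"]
      by (simp add: inner_simps p0_def p1_def p2_def p3_def)
    moreover have "C * p0 + D * p1 - 4 * p2 = 0" "C * p1 + D * p2 - 4 * p3 = 0"
      using arg_cong[OF Gu, of "\<lambda>x. x \<bullet> z"] arg_cong[OF cGu, of "\<lambda>x. x \<bullet> z"]
      by (simp_all add: inner_simps p0_def p1_def p2_def p3_def)
    ultimately show ?thesis using root
      unfolding p0_def[symmetric] p1_def[symmetric] C_def D_def by algebra
  qed
  hence "((2 - 4 * \<mu>) *\<^sub>R (c \<odot> u) - (20 * \<mu>\<^sup>2 - 4 * \<mu> - 12 * k * \<mu> + 3 * k) *\<^sub>R u) \<bullet> z = 0" for z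
    using \<open>\<mu> \<noteq> 1 / 2\<close> by (simp add: inner_simps)
  from this[of "(2 - 4 * \<mu>) *\<^sub>R (c \<odot> u) - (20 * \<mu>\<^sup>2 - 4 * \<mu> - 12 * k * \<mu> + 3 * k) *\<^sub>R u"]
  have lin: "(2 - 4 * \<mu>) *\<^sub>R (c \<odot> u) = (20 * \<mu>\<^sup>2 - 4 * \<mu> - 12 * k * \<mu> + 3 * k) *\<^sub>R u"
    by simp
  define \<tau> where "\<tau> = (20 * \<mu>\<^sup>2 - 4 * \<mu> - 12 * k * \<mu> + 3 * k) / (2 - 4 * \<mu>)"
  have \<tau>: "(2 - 4 * \<mu>) * \<tau> = 20 * \<mu>\<^sup>2 - 4 * \<mu> - 12 * k * \<mu> + 3 * k"
    using \<open>\<mu> \<noteq> 1 / 2\<close> by (simp add: \<tau>_def)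
  have "(2 - 4 * \<mu>) *\<^sub>R (c \<odot> u) = (2 - 4 * \<mu>) *\<^sub>R (\<tau> *\<^sub>R u)" using lin \<tau> by simp
  hence cu: "c \<odot> u = \<tau> *\<^sub>R u" using \<open>\<mu> \<noteq> 1 / 2\<close> by (subst (asm) scaleR_cancel_left) auto
  show ?thesis
  proof (cases "u = 0")
    case True
    hence yy: "y \<odot> y = r *\<^sub>R c" by (simp add: u_def)
    \<comment> \<open>The fourth-order identity with y \<odot> y = r c; after r N = \<mu> |y|^2
      every term is a multiple of \<mu> |y|^4.\<close>
    have "(1 + k) * (r\<^sup>2 * N) - 4 * \<mu> * (r\<^sup>2 * N) - r\<^sup>2 * N = 3 * \<kappa> * (y \<bullet> y) * (\<mu> * (y \<bullet> y))"
      using idempotent_expansion(5)[OF y(1)]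
      by (simp add: y(3) yy distrib c(2) N_def power2_eq_square algebra_simps)
    moreover have "r * N = \<mu> * (y \<bullet> y)" using \<open>N > 0\<close> by (simp add: r_def)
    moreover have "k = \<kappa> * N" by (simp add: k N_def)
    ultimately have "(\<mu> * (y \<bullet> y)\<^sup>2) * (k * (\<mu> - 3) - 4 * \<mu>\<^sup>2) = 0" by algebra
    hence "k * (\<mu> - 3) = 4 * \<mu>\<^sup>2" using \<open>\<mu> \<noteq> 0\<close> \<open>y \<noteq> 0\<close> by simp
    then show ?thesis by (rule parallel)
  next
    case False
    have "4 * \<tau> ^ 3 - 4 * k * \<tau>\<^sup>2 + k * \<tau> + k = 0" by (rule eigenvalue_root[OF uc False cu])
    moreover have "(C + D * \<tau> - 4 * \<tau>\<^sup>2) *\<^sub>R u = 0"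
      using Gu by (simp add: cu distrib algebra_simps power2_eq_square)
    hence "C + D * \<tau> - 4 * \<tau>\<^sup>2 = 0" using False by simp
    \<comment> \<open>The difference of the cubic at \<tau> and at \<mu> is \<tau> - \<mu> times a
      quadratic S. Subtracting from S the vanishing 4\<tau>^2 - D\<tau> - C leaves (2 -
      4\<mu>)(\<tau> - (k - 2\<mu>)).\<close>
    ultimately have "(2 - 4 * \<mu>) * ((\<tau> - \<mu>) * (\<tau> - (k - 2 * \<mu>))) = 0"
      using root unfolding C_def D_def by algebra
    hence "\<tau> = \<mu> \<or> \<tau> = k - 2 * \<mu>" using \<open>\<mu> \<noteq> 1 / 2\<close> by auto
    then show ?thesis
    proof
      assume "\<tau> = \<mu>"
      hence "3 * ((4 * \<mu> - 1) * (k - 2 * \<mu>)) = 0"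
        using \<open>C + D * \<tau> - 4 * \<tau>\<^sup>2 = 0\<close>
        by (simp add: C_def D_def algebra_simps power2_eq_square)
      then show ?thesis by (intro degenerate) simp
    next
      assume *: "\<tau> = k - 2 * \<mu>"
      hence "12 * \<mu>\<^sup>2 - 8 * k * \<mu> + k = 0" using \<tau> by algebra
      with * show ?thesis using double_root[OF uc False] cu by simp
    qed
  qed
qed

text \<open>Each alternative of \<open>eigenvector_square_cases\<close> is combined with the cubic.
  The first two force k = -1; a double root passes the question on to the third root \<nu>.\<close>

lemma no_negative_eigenvalue:
  assumes y: "y \<bullet> c = 0" "y \<noteq> 0" "c \<odot> y = \<mu> *\<^sub>R y" and "k < 0" "k \<noteq> -1"
  shows "\<mu> \<ge> 0"
proof (rule ccontr)
  assume "\<not> \<mu> \<ge> 0"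
  hence \<mu>: "\<mu> < 0" "\<mu> \<noteq> 1 / 2" by auto
  have "k \<noteq> 0" using \<open>k < 0\<close> by simp
  have root: "4 * \<mu> ^ 3 - 4 * k * \<mu>\<^sup>2 + k * \<mu> + k = 0" by (rule eigenvalue_root[OF y])
  show False
    using y \<mu>(2) \<open>k \<noteq> 0\<close>
  proof (cases rule: eigenvector_square_cases)
    case parallel
    \<comment> \<open>Replacing 4\<mu>^2 by k(\<mu> - 3) in the leading term makes the cubic k times
      a quadratic.\<close>
    hence "k * ((3 * \<mu> - 1) * (\<mu> + 1)) = 0" using root by algebra
    hence "\<mu> = -1" using \<mu> \<open>k \<noteq> 0\<close> by auto
    then show False using parallel \<open>k \<noteq> -1\<close> by simp
  next
    case degenerate
    hence "k = 2 * \<mu>" using \<mu> by auto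
    hence "\<mu> * ((2 * \<mu> + 1) * (\<mu> - 1)) = 0" using root by algebra
    hence "2 * \<mu> + 1 = 0" using \<mu> by auto
    then show False using \<open>k = 2 * \<mu>\<close> \<open>k \<noteq> -1\<close> by simp
  next
    case (double_root u)
    (* \<mu> is a double root and \<nu> the remaining simple root, so the same lemma can be applied to u. *)
    define \<nu> where "\<nu> = k - 2 * \<mu>"
    \<comment> \<open>Vieta for the product of the roots \<mu>, \<mu>, \<nu>.\<close>
    have kk: "k = - 4 * \<mu>\<^sup>2 * \<nu>"
      using root double_root(4) unfolding \<nu>_def by algebra
    have "\<nu> > 0" using kk \<open>k < 0\<close> \<mu> by (auto simp: zero_less_mult_iff mult_less_0_iff)
    have cu: "c \<odot> u = \<nu> *\<^sub>R u" using double_root(3) by (simp add: \<nu>_def)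
    have root': "4 * \<nu> ^ 3 - 4 * k * \<nu>\<^sup>2 + k * \<nu> + k = 0"
      by (rule eigenvalue_root[OF double_root(1,2) cu])
    \<comment> \<open>The cubic takes the value (1 + k)/2 at 1/2.\<close>
    have "\<nu> \<noteq> 1 / 2"
    proof
      assume "\<nu> = 1 / 2"
      with root' \<open>k \<noteq> -1\<close> show False by (simp add: power2_eq_square power3_eq_cube)
    qed
    from double_root(1,2) cu this \<open>k \<noteq> 0\<close> show False
    proof (cases rule: eigenvector_square_cases)
      case parallel
      hence "k * ((3 * \<nu> - 1) * (\<nu> + 1)) = 0" using root' by algebra
      hence "\<nu> = 1 / 3" using \<open>\<nu> > 0\<close> \<open>k \<noteq> 0\<close> by auto
      then have "k = - 1 / 6" using parallel unfolding \<open>\<nu> = 1 / 3\<close> by (simp add: power2_eq_square)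
      have "\<mu> = - 1 / 4" using \<nu>_def unfolding \<open>\<nu> = 1 / 3\<close> \<open>k = - 1 / 6\<close> by simp
      show False using kk unfolding \<open>\<nu> = 1 / 3\<close> \<open>k = - 1 / 6\<close> \<open>\<mu> = - 1 / 4\<close> by (simp add: power2_eq_square)
    next
      case degenerate
      hence "\<nu> = 1 / 4" using \<open>\<nu> > 0\<close> \<open>k < 0\<close> by auto
      hence "k = - 1 / 16" using root' unfolding \<open>\<nu> = 1 / 4\<close> by (simp add: power2_eq_square power3_eq_cube)
      have "\<mu> = - 5 / 32" using \<nu>_def unfolding \<open>\<nu> = 1 / 4\<close> \<open>k = - 1 / 16\<close> by simp
      show False using kk unfolding \<open>\<nu> = 1 / 4\<close> \<open>k = - 1 / 16\<close> \<open>\<mu> = - 5 / 32\<close> by (simp add: power2_eq_square)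
    next
      case (double_root u')
      \<comment> \<open>The cubic is 4 (X - \<mu>)^2 (X - \<nu>), so its derivative at \<nu> is 4
        (\<nu> - \<mu>)^2.\<close>
      have "4 * (\<nu> - \<mu>)\<^sup>2 = 0"
        using double_root(4) \<open>12 * \<mu>\<^sup>2 - 8 * k * \<mu> + k = 0\<close> unfolding \<nu>_def by algebra
      then show False using \<mu> \<open>\<nu> > 0\<close> by simp
    qed
  qed
qed

section \<open>The value of k and the vanishing of the trace\<close>

text \<open>Projecting the standard basis computes the trace on the complement without choosing a
  basis there: the full trace 1 + k loses the eigenvalue 1 of c.\<close>

lemma trace_orthogonal:
  "(\<Sum>b\<in>Basis. (c \<odot> (b - ((b \<bullet> c) / (c \<bullet> c)) *\<^sub>R c)) \<bullet> (b - ((b \<bullet> c) / (c \<bullet> c)) *\<^sub>R c)) = k"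
proof -
  have N: "c \<bullet> c \<noteq> 0" using c by simp
  have "(c \<odot> (b - ((b \<bullet> c) / (c \<bullet> c)) *\<^sub>R c)) \<bullet> (b - ((b \<bullet> c) / (c \<bullet> c)) *\<^sub>R c)
      = (c \<odot> b) \<bullet> b - (b \<bullet> c)\<^sup>2 / (c \<bullet> c)" for b
  proof -
    have "(c \<odot> b) \<bullet> c = b \<bullet> c" "c \<bullet> b = b \<bullet> c" using self_adjoint[of c b c] by (simp_all add: c(2) inner_commute)
    then show ?thesis using N by (simp add: distrib c(2) inner_simps power2_eq_square)
  qed
  moreover have "(\<Sum>b\<in>Basis. (b \<bullet> c)\<^sup>2 / (c \<bullet> c)) = 1"
    using N by (subst sum_divide_distrib[symmetric])
      (simp add: euclidean_inner[of c c] power2_eq_square inner_commute)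
  ultimately show ?thesis
    using idempotent_expansion(1)[of 0] by (simp add: sum_subtractf tr_def)
qed

lemma maximal_idempotent_constant:
  assumes "k \<noteq> 0" and max: "\<And>y. y \<bullet> c = 0 \<Longrightarrow> (c \<odot> y) \<bullet> y \<le> (y \<bullet> y) / 2"
  shows "k = -1"
proof (rule ccontr)
  assume "k \<noteq> -1"
  define W where "W = {y. c \<bullet> y = 0}"
  define h where "h b = b - ((b \<bullet> c) / (c \<bullet> c)) *\<^sub>R c" for b
  have W: "subspace W" unfolding W_def by (rule subspace_hyperplane)
  have cW: "c \<odot> x \<in> W" "- (c \<odot> x) \<in> W" if "x \<in> W" for x
    using that orthogonal_mult[of x] by (simp_all add: W_def inner_commute)
  have hW: "h b \<in> W" for b using c by (simp add: h_def W_def inner_simps inner_commute)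
  have lin: "linear (\<lambda>x. c \<odot> x)" using bilin by (simp add: bilinear_def)
  have sum: "(\<Sum>b\<in>Basis. (c \<odot> h b) \<bullet> h b) = k"
    unfolding h_def by (rule trace_orthogonal)
  consider "k > 0" | "k < 0" using \<open>k \<noteq> 0\<close> by linarith
  then show False
  proof cases
    case 1
    obtain b where "(c \<odot> h b) \<bullet> h b > 0"
      using sum 1 by (metis (no_types, lifting) not_less sum_nonpos)
    then obtain y \<mu> where y: "y \<in> W" "y \<noteq> 0" "c \<odot> y = \<mu> *\<^sub>R y" "\<mu> > 0"
      using self_adjoint_positive_eigenvector[OF lin self_adjoint W cW(1) hW] by blast
    have yc: "y \<bullet> c = 0" using y by (simp add: W_def inner_commute)
    have "\<mu> * (y \<bullet> y) \<le> 1 / 2 * (y \<bullet> y)" using max[OF yc] y by simp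
    hence "\<mu> \<le> 1 / 2" using y(2) by (subst (asm) mult_le_cancel_right_pos) auto
    have root: "4 * \<mu> ^ 3 - 4 * k * \<mu>\<^sup>2 + k * \<mu> + k = 0" by (rule eigenvalue_root[OF yc y(2,3)])
    \<comment> \<open>On (0, 1/2], 4\<mu>^2 \<le> 2\<mu> < 1 + \<mu>, so the cubic is positive
      there.\<close>
    have "\<mu> * (4 * \<mu>) \<le> \<mu> * 2" using \<open>\<mu> \<le> 1 / 2\<close> \<open>\<mu> > 0\<close> by (intro mult_left_mono) auto
    hence "1 + \<mu> - 4 * \<mu>\<^sup>2 > 0" using \<open>\<mu> \<le> 1 / 2\<close> by (simp add: power2_eq_square)
    hence "4 * \<mu> ^ 3 + k * (1 + \<mu> - 4 * \<mu>\<^sup>2) > 0" using 1 \<open>\<mu> > 0\<close> by (intro add_pos_pos) auto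
    with root show False by (simp add: algebra_simps)
  next
    case 2
    \<comment> \<open>A positive eigenvalue of the negated multiplication is a negative eigenvalue
      of the original one.\<close>
    have lin': "linear (\<lambda>x. - (c \<odot> x))" using lin by (rule linear_compose_neg)
    obtain b where "- (c \<odot> h b) \<bullet> h b > 0"
      using sum 2 by (metis (no_types, lifting) not_less sum_nonneg inner_minus_left neg_0_less_iff_less)
    moreover have "- (c \<odot> x) \<bullet> z = x \<bullet> - (c \<odot> z)" for x z by (simp add: self_adjoint)
    ultimately obtain y \<mu> where y: "y \<in> W" "y \<noteq> 0" "- (c \<odot> y) = \<mu> *\<^sub>R y" "\<mu> > 0"
      using self_adjoint_positive_eigenvector[OF lin' _ W cW(2) hW] by blast
    have "c \<odot> y = (- \<mu>) *\<^sub>R y" using y(3) by (metis minus_minus scaleR_minus_left)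
    moreover have "y \<bullet> c = 0" using y by (simp add: W_def inner_commute)
    ultimately have "- \<mu> \<ge> 0"
      using no_negative_eigenvalue[OF _ y(2)] 2 \<open>k \<noteq> -1\<close> by blast
    with y(4) show False by simp
  qed
qed

end

text \<open>The linear form \<open>tr\<close> vanishes on the complement of c, and at c because 1 +
  k = 0.\<close>

lemma trace_zero:
  assumes "\<kappa> \<noteq> 0" and "(x0 \<odot> x0) \<bullet> x0 \<noteq> 0"
  shows "tr x = 0"
proof -
  obtain c where c: "c \<noteq> 0" "c \<odot> c = c" "\<And>y. y \<bullet> c = 0 \<Longrightarrow> (c \<odot> y) \<bullet> y \<le> (y \<bullet> y) / 2"
    using exists_maximal_idempotent[OF assms(2)] by blast
  have k: "\<kappa> * (c \<bullet> c) = -1"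
    by (rule maximal_idempotent_constant[OF c(1,2) refl]) (use c assms(1) in auto)
  define r where "r = (x \<bullet> c) / (c \<bullet> c)"
  have "(x - r *\<^sub>R c) \<bullet> c = 0" using c(1) by (simp add: r_def inner_simps)
  from idempotent_expansion(2)[OF c(1,2) refl this]
  have "tr (x - r *\<^sub>R c) = 0" .
  moreover have "tr c = 0" using idempotent_expansion(1)[OF c(1,2) refl, of 0] k by simp
  moreover have "x = (x - r *\<^sub>R c) + r *\<^sub>R c" by simp
  ultimately show ?thesis by (metis tr_linear add_0 mult_zero_right)
qed

end

section \<open>Cubic forms as metrized algebras\<close>

lemma monomial_Suc:
  fixes a :: "'n::finite \<Rightarrow> nat"
  assumes "(\<Sum>i\<in>UNIV. a i) = Suc d"
  obtains p b where "(\<Sum>i\<in>UNIV. b i) = d"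
    "\<And>x :: real ^ 'n. (\<Prod>i\<in>UNIV. (x $ i) ^ a i) = x $ p * (\<Prod>i\<in>UNIV. (x $ i) ^ b i)"
proof -
  have "\<exists>p. a p \<noteq> 0" using assms by (metis Zero_not_Suc sum.neutral)
  then obtain p where "a p \<noteq> 0" ..
  then obtain m where m: "a p = Suc m" using not0_implies_Suc by blast
  define b where "b = a(p := m)"
  have b: "b i = a i" if "i \<in> UNIV - {p}" for i using that by (simp add: b_def)
  show ?thesis
  proof (rule that)
    have "(\<Sum>i\<in>UNIV. a i) = Suc m + sum a (UNIV - {p})" "(\<Sum>i\<in>UNIV. b i) = m + sum b (UNIV - {p})"
      using m by (simp_all add: sum.remove[of _ p] b_def)
    moreover have "sum a (UNIV - {p}) = sum b (UNIV - {p})" using b by (intro sum.cong) auto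
    ultimately show "(\<Sum>i\<in>UNIV. b i) = d" using assms by simp
    fix x :: "real ^ 'n"
    have "(\<Prod>i\<in>UNIV. (x $ i) ^ a i) = (x $ p) ^ Suc m * (\<Prod>i\<in>UNIV - {p}. (x $ i) ^ a i)"
      "(\<Prod>i\<in>UNIV. (x $ i) ^ b i) = (x $ p) ^ m * (\<Prod>i\<in>UNIV - {p}. (x $ i) ^ b i)"
      using m by (simp_all add: prod.remove[of _ p] b_def)
    moreover have "(\<Prod>i\<in>UNIV - {p}. (x $ i) ^ a i) = (\<Prod>i\<in>UNIV - {p}. (x $ i) ^ b i)"
      using b by (intro prod.cong) auto
    ultimately show "(\<Prod>i\<in>UNIV. (x $ i) ^ a i) = x $ p * (\<Prod>i\<in>UNIV. (x $ i) ^ b i)" by simp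
  qed
qed

text \<open>Three coordinate factors, possibly repeated, are the form in which a monomial can be
  polarised explicitly.\<close>

lemma cubic_monomial:
  fixes a :: "'n::finite \<Rightarrow> nat"
  assumes "(\<Sum>i\<in>UNIV. a i) = 3"
  shows "\<exists>p q r. \<forall>x :: real ^ 'n. (\<Prod>i\<in>UNIV. (x $ i) ^ a i) = x $ p * x $ q * x $ r"
proof -
  have "(\<Sum>i\<in>UNIV. a i) = Suc (Suc (Suc 0))" using assms by simp
  then obtain p b where b: "(\<Sum>i\<in>UNIV. b i) = Suc (Suc 0)"
    "\<And>x :: real ^ 'n. (\<Prod>i\<in>UNIV. (x $ i) ^ a i) = x $ p * (\<Prod>i\<in>UNIV. (x $ i) ^ b i)"
    by (rule monomial_Suc) blast
  from b(1) obtain q e where e: "(\<Sum>i\<in>UNIV. e i) = Suc 0"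
    "\<And>x :: real ^ 'n. (\<Prod>i\<in>UNIV. (x $ i) ^ b i) = x $ q * (\<Prod>i\<in>UNIV. (x $ i) ^ e i)"
    by (rule monomial_Suc) blast
  from e(1) obtain r g where g: "(\<Sum>i\<in>UNIV. g i) = 0"
    "\<And>x :: real ^ 'n. (\<Prod>i\<in>UNIV. (x $ i) ^ e i) = x $ r * (\<Prod>i\<in>UNIV. (x $ i) ^ g i)"
    by (rule monomial_Suc) blast
  have "(\<Prod>i\<in>UNIV. (x $ i) ^ g i) = 1" for x :: "real ^ 'n" using g(1) by simp
  then show ?thesis by (intro exI[of _ p] exI[of _ q] exI[of _ r]) (simp add: b(2) e(2) g(2))
qed

text \<open>The product is the polarisation of the cubic, so that \<open>mul x y\<close> is the Hessian of \<open>f\<close>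
  at \<open>x\<close> applied to \<open>y\<close>; the factor 6 comes from the six permutations.\<close>

lemma cubic_algebra:
  fixes f :: "real ^ 'n \<Rightarrow> real"
  assumes "homogeneous_polynomial 3 f"
  obtains mul where "metrized_algebra mul" "\<And>x. f x = (mul x x \<bullet> x) / 6"
proof -
  obtain c where c: "\<And>x. f x = (\<Sum>a | (\<Sum>i\<in>UNIV. a i) = 3. c a * (\<Prod>i\<in>UNIV. (x $ i) ^ a i))"
    using assms by (auto simp: homogeneous_polynomial_def)
  define I where "I = {a :: 'n \<Rightarrow> nat. (\<Sum>i\<in>UNIV. a i) = 3}"
  have "\<forall>a\<in>I. \<exists>p q r. \<forall>x :: real ^ 'n. (\<Prod>i\<in>UNIV. (x $ i) ^ a i) = x $ p * x $ q * x $ r"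
    by (auto simp: I_def intro: cubic_monomial)
  from bchoice[OF this] obtain p where
    "\<forall>a\<in>I. \<exists>q r. \<forall>x :: real ^ 'n. (\<Prod>i\<in>UNIV. (x $ i) ^ a i) = x $ p a * x $ q * x $ r" ..
  from bchoice[OF this] obtain q where
    "\<forall>a\<in>I. \<exists>r. \<forall>x :: real ^ 'n. (\<Prod>i\<in>UNIV. (x $ i) ^ a i) = x $ p a * x $ q a * x $ r" ..
  from bchoice[OF this] obtain r where
    pqr: "\<forall>a\<in>I. \<forall>x :: real ^ 'n. (\<Prod>i\<in>UNIV. (x $ i) ^ a i) = x $ p a * x $ q a * x $ r a" ..
  \<comment> \<open>The axis vectors carry the third argument: pairing with z sums each monomial
    over all six placements of x, y, z, so the trilinear form is totally symmetric.\<close>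
  define mul :: "real ^ 'n \<Rightarrow> real ^ 'n \<Rightarrow> real ^ 'n" where
    "mul x y = (\<Sum>a\<in>I. c a *\<^sub>R ((x $ p a * y $ q a + y $ p a * x $ q a) *\<^sub>R axis (r a) 1
      + (x $ p a * y $ r a + y $ p a * x $ r a) *\<^sub>R axis (q a) 1
      + (x $ q a * y $ r a + y $ q a * x $ r a) *\<^sub>R axis (p a) 1))" for x y
  have comm: "mul x y = mul y x" for x y by (simp add: mul_def algebra_simps)
  have lin: "linear (mul x)" for x
    by (rule linearI) (simp_all add: mul_def algebra_simps sum.distrib scaleR_sum_right)
  have inner: "mul x y \<bullet> z = (\<Sum>a\<in>I. c a * ((x $ p a * y $ q a + y $ p a * x $ q a) * z $ r a
      + (x $ p a * y $ r a + y $ p a * x $ r a) * z $ q a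
      + (x $ q a * y $ r a + y $ q a * x $ r a) * z $ p a))" for x y z
    by (simp add: mul_def inner_sum_left inner_simps inner_axis')
  show ?thesis
  proof
    show "metrized_algebra mul"
    proof
      show "bilinear mul" using lin by (simp add: bilinear_def comm[of _ y for y])
      show "mul x y = mul y x" for x y by (rule comm)
      show "mul x y \<bullet> z = x \<bullet> mul y z" for x y z
        unfolding inner_commute[of x] inner by (intro sum.cong) (simp_all add: algebra_simps)
    qed
    fix x
    have "f x = (\<Sum>a\<in>I. c a * (x $ p a * x $ q a * x $ r a))"
      unfolding c I_def[symmetric] by (intro sum.cong) (simp_all add: pqr)
    also have "\<dots> = (mul x x \<bullet> x) / 6"
      unfolding inner sum_divide_distrib by (intro sum.cong) (simp_all add: field_simps)
    finally show "f x = (mul x x \<bullet> x) / 6" .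
  qed
qed

text \<open>By \<open>cube_expand\<close> f is a cubic in t along each axis, so its gradient is half
  of \<open>mul x x\<close> and its Hessian is multiplication by x. The two gradient factors in
  \<open>L_op\<close> account for the 4.\<close>

lemma
  fixes f :: "real ^ 'n \<Rightarrow> real" and mul :: "real ^ 'n \<Rightarrow> real ^ 'n \<Rightarrow> real ^ 'n"
  assumes alg: "metrized_algebra mul" and f: "\<And>x. f x = (mul x x \<bullet> x) / 6"
  shows laplacian_cubic: "laplacian f x = metrized_algebra.tr mul x"
    and L_op_cubic: "4 * L_op f x = (mul x x \<bullet> mul x x) * metrized_algebra.tr mul x - mul x x \<bullet> mul x (mul x x)"
proof -
  interpret metrized_algebra mul by (rule alg)
  have partial1: "partial i f = (\<lambda>x. (mul x x $ i) / 2)" for i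
  proof
    fix x
    have "((\<lambda>t. f (x + t *\<^sub>R axis i 1)) has_real_derivative (mul x x \<bullet> axis i 1) / 2) (at 0)"
      unfolding f cube_expand by (auto intro!: derivative_eq_intros)
    then show "partial i f x = (mul x x $ i) / 2"
      unfolding partial_def by (simp add: DERIV_imp_deriv inner_axis)
  qed
  have partial2: "partial j (partial i f) x = mul x (axis j 1) $ i" for i j x
  proof -
    have "((\<lambda>t. partial i f (x + t *\<^sub>R axis j 1)) has_real_derivative mul x (axis j 1) $ i) (at 0)"
      unfolding partial1 by (auto intro!: derivative_eq_intros simp: distrib commute[of "axis j 1" x])
    then show ?thesis unfolding partial_def[of j] by (rule DERIV_imp_deriv)
  qed
  have grad: "gradient f x = (1 / 2) *\<^sub>R mul x x"
    by (simp add: gradient_def partial1 vec_eq_iff)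
  have Basis: "(Basis :: (real ^ 'n) set) = (\<lambda>i. axis i 1) ` UNIV"
    by (auto simp: Basis_vec_def)
  have "inj (\<lambda>i. axis i 1 :: real ^ 'n)" by (auto simp: inj_on_def axis_eq_axis)
  then show lap: "laplacian f x = tr x"
    by (simp add: laplacian_def partial2 tr_def Basis sum.reindex inner_axis)
  have inner_sum: "(\<Sum>i\<in>UNIV. mul x x $ i * mul x (axis j 1) $ i) = mul x (mul x x) $ j" for j
  proof -
    have "(\<Sum>i\<in>UNIV. mul x x $ i * mul x (axis j 1) $ i) = mul x x \<bullet> mul x (axis j 1)"
      by (simp add: inner_vec_def)
    also have "\<dots> = mul x (mul x x) \<bullet> axis j 1" by (simp add: self_adjoint)
    finally show ?thesis by (simp add: inner_axis)
  qed
  have "(\<Sum>i\<in>UNIV. \<Sum>j\<in>UNIV. partial i f x * partial j f x * partial j (partial i f) x)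
      = (\<Sum>j\<in>UNIV. (mul x x $ j) / 4 * (\<Sum>i\<in>UNIV. mul x x $ i * mul x (axis j 1) $ i))"
    unfolding partial2 by (subst sum.swap) (simp add: partial1 sum_distrib_left mult_ac)
  also have "\<dots> = (mul x x \<bullet> mul x (mul x x)) / 4"
    unfolding inner_sum by (simp add: inner_vec_def sum_divide_distrib)
  finally have "(\<Sum>i\<in>UNIV. \<Sum>j\<in>UNIV. partial i f x * partial j f x * partial j (partial i f) x)
      = (mul x x \<bullet> mul x (mul x x)) / 4" .
  moreover have "(norm (gradient f x))\<^sup>2 = (mul x x \<bullet> mul x x) / 4"
    unfolding grad power2_norm_eq_inner by simp
  ultimately show "4 * L_op f x = (mul x x \<bullet> mul x x) * tr x - mul x x \<bullet> mul x (mul x x)"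
    by (simp only: L_op_def lap) simp
qed

(* For a radial eigencubic, L_op f \<noteq> 0 says that the constant c (lambda) is nonzero.
   The case c = 0 has to be excluded: f x = (x $ k) ^ 3 satisfies
   L_op f = 0 = 0 * |x|^2 * f but is not harmonic. *)
theorem theorem1:
  fixes f :: "real ^ 'n \<Rightarrow> real"
  assumes "radial_eigencubic f"
    and "\<exists>x. L_op f x \<noteq> 0"
  shows "harmonic f"
proof -
  obtain x0 c where "f x0 \<noteq> 0" and L: "\<And>x. L_op f x = c * (norm x)\<^sup>2 * f x"
    and "homogeneous_polynomial 3 f"
    using assms(1) by (auto simp: radial_eigencubic_def)
  then obtain mul where alg: "metrized_algebra mul" and f: "\<And>x. f x = (mul x x \<bullet> x) / 6"
    using cubic_algebra by blast
  \<comment> \<open>The factor 2/3 is 4/6: 4 from \<open>L_op_cubic\<close>, 1/6 from f in terms of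
    the product.\<close>
  interpret hsiang_algebra mul "2 / 3 * c"
  proof (intro hsiang_algebra.intro[OF alg] hsiang_algebra_axioms.intro)
    show "(mul x x \<bullet> mul x x) * metrized_algebra.tr mul x - mul x x \<bullet> mul x (mul x x)
        = 2 / 3 * c * (x \<bullet> x) * (mul x x \<bullet> x)" for x
      unfolding L_op_cubic[OF alg f, symmetric] L by (simp add: f power2_norm_eq_inner)
  qed
  have "c \<noteq> 0" using assms(2) L by auto
  moreover have "mul x0 x0 \<bullet> x0 \<noteq> 0" using \<open>f x0 \<noteq> 0\<close> by (simp add: f)
  ultimately have "tr x = 0" for x using trace_zero by simp
  then show ?thesis by (simp add: harmonic_def laplacian_cubic[OF alg f])
qed

end
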